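(* Let $n\in\mathbb{N}$, $\Phi\in\mathbb{R}^{n\times n}$, $h\in\mathbb{R}^n$ with $\operatorname{rank}(h,\Phi h,\dots,\Phi^{n-1}h)=n$. Let $S\in\mathbb{R}^{n\times n}$ be symmetric positive definite, let $r>0$, and let $c\in\mathbb{R}^n$ be such that the $n\times n$ matrix with rows $c^T, c^T\Phi,\dots,c^T\Phi^{n-1}$ has rank $n$. Let $w>0$ and set $\Phi_w=\frac1w\Phi$, $h_w=\frac1w h$. Let $k_w^*\in\mathbb{R}^n$ be the limit, as $N\to\infty$, of the optimal feedback vectors $k_0^{(N)}$ obtained from the backward Riccati recursion for the data $(\Phi_w,h_w,c,r,S)$, as defined in the context. Then $$\rho\left(\Phi-h\,(k_w^* )^T\right)<w,$$ where $\rho$ denotes the spectral radius.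
   Context: Backward Riccati recursion for $(\Phi_w,h_w,c,r,S)$: put $Q=cc^T$. For each $N\in\mathbb{N}$ set $P_N^{(N)}=S$ and, for $m=N-1,N-2,\dots,1$, $$P_m^{(N)}=Q+\Phi_w^T\left[P_{m+1}^{(N)}-\frac{1}{r+h_w^TP_{m+1}^{(N)}h_w}\,P_{m+1}^{(N)}h_wh_w^TP_{m+1}^{(N)}\right]\Phi_w .$$ Then define $$(k_0^{(N)})^T=\frac{1}{r+h_w^TP_1^{(N)}h_w}\;h_w^TP_1^{(N)}\Phi_w .$$ Under the hypotheses of the claim, the sequence $(k_0^{(N)})_{N\in\mathbb{N}}$ converges in $\mathbb{R}^n$; its limit is denoted $k_w^*$. (These vectors arise from minimizing $\frac12 z_N^TSz_N+\frac12\sum_{m=0}^{N-1}(z_m^TQz_m+r u_m^2)$ subject to $z_{m+1}=\Phi_wz_m+h_wu_m$, with optimal feedback $u_m=-k_m^Tz_m$.) *)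

theory Defs
  imports
    Complex_Main
    "Jordan_Normal_Form.DL_Rank"
    "Jordan_Normal_Form.Spectral_Radius"
begin

definition outer_prod :: "real vec \<Rightarrow> real vec \<Rightarrow> real mat" where
  "outer_prod u v = mat (dim_vec u) (dim_vec v) (\<lambda>(i, j). u $ i * v $ j)"

text \<open>The matrix with columns \<open>h, A h, \<dots>, A^(n-1) h\<close>.\<close>

definition controllability_mat :: "nat \<Rightarrow> real mat \<Rightarrow> real vec \<Rightarrow> real mat" where
  "controllability_mat n A h = mat_of_cols n (map (\<lambda>i. (A ^\<^sub>m i) *\<^sub>v h) [0..<n])"

text \<open>The matrix with rows \<open>c^T, c^T A, \<dots>, c^T A^(n-1)\<close>; the row vector \<open>c^T M\<close> is
  represented by the vector \<open>M^T c\<close>.\<close>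

definition observability_mat :: "nat \<Rightarrow> real mat \<Rightarrow> real vec \<Rightarrow> real mat" where
  "observability_mat n A c = mat_of_rows n (map (\<lambda>i. (A ^\<^sub>m i)\<^sup>T *\<^sub>v c) [0..<n])"

definition sym_pos_def :: "nat \<Rightarrow> real mat \<Rightarrow> bool" where
  "sym_pos_def n S \<longleftrightarrow> S \<in> carrier_mat n n \<and> S\<^sup>T = S \<and>
     (\<forall>x \<in> carrier_vec n. x \<noteq> 0\<^sub>v n \<longrightarrow> x \<bullet> (S *\<^sub>v x) > 0)"

definition riccati_step ::
  "real mat \<Rightarrow> real vec \<Rightarrow> real vec \<Rightarrow> real \<Rightarrow> real mat \<Rightarrow> real mat" where
  "riccati_step A h c r P =
     outer_prod c c +
     A\<^sup>T * (P - (1 / (r + h \<bullet> (P *\<^sub>v h))) \<cdot>\<^sub>m (P * outer_prod h h * P)) * A"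

text \<open>\<open>riccati A h c r S N m\<close> is \<open>P_m^(N)\<close>. It is meaningful for \<open>1 \<le> m \<le> N\<close>;
  for \<open>m > N\<close> the value is \<open>S\<close> by convention.\<close>

function riccati ::
  "real mat \<Rightarrow> real vec \<Rightarrow> real vec \<Rightarrow> real \<Rightarrow> real mat \<Rightarrow> nat \<Rightarrow> nat \<Rightarrow> real mat" where
  "riccati A h c r S N m =
     (if m < N then riccati_step A h c r (riccati A h c r S N (Suc m)) else S)"
  by pat_completeness auto
termination
  by (relation "Wellfounded.measure (\<lambda>(A, h, c, r, S, N, m). N - m)") auto

declare riccati.simps [simp del]

text \<open>The feedback vector \<open>k_0^(N)\<close> as a column vector: the row vector \<open>h^T P A\<close> is
  represented by \<open>(P A)^T h\<close>.\<close>

definition riccati_gain ::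
  "real mat \<Rightarrow> real vec \<Rightarrow> real vec \<Rightarrow> real \<Rightarrow> real mat \<Rightarrow> nat \<Rightarrow> real vec" where
  "riccati_gain A h c r S N =
     (let P = riccati A h c r S N 1
      in (1 / (r + h \<bullet> (P *\<^sub>v h))) \<cdot>\<^sub>v ((P * A)\<^sup>T *\<^sub>v h))"

text \<open>The type \<^typ>\<open>real vec\<close> carries no topology, so convergence in \<open>R^n\<close> is
  expressed componentwise.\<close>

definition vec_tendsto :: "nat \<Rightarrow> (nat \<Rightarrow> real vec) \<Rightarrow> real vec \<Rightarrow> bool" where
  "vec_tendsto n v l \<longleftrightarrow> l \<in> carrier_vec n \<and> (\<forall>N. v N \<in> carrier_vec n) \<and>
     (\<forall>i<n. (\<lambda>N. v N $ i) \<longlonglongrightarrow> l $ i)"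

definition vec_lim :: "nat \<Rightarrow> (nat \<Rightarrow> real vec) \<Rightarrow> real vec" where
  "vec_lim n v = vec n (\<lambda>i. lim (\<lambda>N. v N $ i))"

end

theory Submission
  imports Defs
begin

text \<open>\<open>F\<^sup>N(S)\<close>, with \<open>F\<close> the Riccati map, is the matrix of the optimal \<open>N\<close>-step cost with
  terminal cost \<open>S\<close>. Started at \<open>0\<close> the iteration is increasing, and it is bounded because
  controllability allows every state to be steered to the origin; it thus tends to a fixed point
  \<open>P\<close>. Along the closed loop of \<open>P\<close> the form \<open>z\<^sup>T P z\<close> decreases by the running cost,
  which therefore tends to \<open>0\<close>; by observability so do the states. Hence \<open>F\<^sup>N(S)\<close>, which
  lies between \<open>F\<^sup>N(0)\<close> and the cost of using the gain of \<open>P\<close> for \<open>N\<close> steps with terminal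
  cost \<open>S\<close>, also tends to \<open>P\<close>, and the gains converge to the gain of \<open>P\<close>. Since all
  closed-loop trajectories tend to \<open>0\<close>, the closed-loop eigenvalues have modulus less than
  \<open>1\<close>.\<close>

section \<open>Quadratic forms\<close>

text \<open>All comparisons and limits of matrices are expressed through these scalars, so order and
  convergence are those of the reals.\<close>

definition form :: "real mat \<Rightarrow> real vec \<Rightarrow> real vec \<Rightarrow> real" where
  "form P x y = x \<bullet> (P *\<^sub>v y)"

lemma outer_prod_carrier [simp]:
  "u \<in> carrier_vec n \<Longrightarrow> v \<in> carrier_vec m \<Longrightarrow> outer_prod u v \<in> carrier_mat n m"
  by (auto simp: outer_prod_def)

lemma outer_prod_mult_vec:
  assumes "v \<in> carrier_vec n" "x \<in> carrier_vec n"
  shows "outer_prod u v *\<^sub>v x = (v \<bullet> x) \<cdot>\<^sub>v u"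
  using assms
  by (intro eq_vecI) (auto simp: outer_prod_def scalar_prod_def sum_distrib_right intro!: sum.cong)

lemma smult_mat_mult_vec:
  assumes "(P :: real mat) \<in> carrier_mat n m" "x \<in> carrier_vec m"
  shows "(a \<cdot>\<^sub>m P) *\<^sub>v x = a \<cdot>\<^sub>v (P *\<^sub>v x)"
  using assms by (intro eq_vecI) auto

text \<open>Each step of the recursion uses the same data, so the result depends only on the
  remaining horizon \<open>N - m\<close>.\<close>

lemma riccati_eq_funpow:
  "m \<le> N \<Longrightarrow> riccati A h c r S N m = (riccati_step A h c r ^^ (N - m)) S"
proof (induction "N - m" arbitrary: m)
  case 0
  then show ?case by (simp add: riccati.simps)
next
  case (Suc k)
  then have "N - m = Suc (N - Suc m)" "m < N" by linarith+
  with Suc show ?case by (simp add: riccati.simps[of _ _ _ _ _ _ m])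
qed

text \<open>\<open>riccati_gain\<close> as a function of the cost matrix, so that it can be
  evaluated at the limit matrix as well.\<close>

definition gain :: "real mat \<Rightarrow> real vec \<Rightarrow> real \<Rightarrow> real mat \<Rightarrow> real vec" where
  "gain A h r P = (1 / (r + form P h h)) \<cdot>\<^sub>v ((P * A)\<^sup>T *\<^sub>v h)"

lemma riccati_gain_eq:
  "riccati_gain A h c r S N = gain A h r ((riccati_step A h c r ^^ (N - 1)) S)"
proof (cases "N \<ge> 1")
  case True
  then show ?thesis
    by (simp add: riccati_gain_def gain_def form_def riccati_eq_funpow Let_def)
next
  \<comment> \<open>For \<open>N = 0\<close> both sides use \<open>S\<close>: the recursion returns
    \<open>S\<close> beyond the horizon, and \<open>0 - 1 = 0\<close>.\<close>
  case False
  then show ?thesis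
    by (simp add: riccati_gain_def gain_def form_def riccati.simps Let_def)
qed

definition pos_semidef :: "nat \<Rightarrow> real mat \<Rightarrow> bool" where
  "pos_semidef n P \<longleftrightarrow> P \<in> carrier_mat n n \<and>
     (\<forall>x\<in>carrier_vec n. \<forall>y\<in>carrier_vec n. form P x y = form P y x) \<and>
     (\<forall>x\<in>carrier_vec n. 0 \<le> form P x x)"

lemma pos_semidefD:
  assumes "pos_semidef n P"
  shows "P \<in> carrier_mat n n"
    and "x \<in> carrier_vec n \<Longrightarrow> y \<in> carrier_vec n \<Longrightarrow> form P x y = form P y x"
    and "x \<in> carrier_vec n \<Longrightarrow> 0 \<le> form P x x"
  using assms by (auto simp: pos_semidef_def)

context
  fixes n :: nat and P :: "real mat"
  assumes P: "P \<in> carrier_mat n n"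
begin

lemma form_add_left:
  assumes "x \<in> carrier_vec n" "y \<in> carrier_vec n" "z \<in> carrier_vec n"
  shows "form P (x + y) z = form P x z + form P y z"
  unfolding form_def using P assms by (intro add_scalar_prod_distrib) auto

lemma form_add_right:
  assumes "x \<in> carrier_vec n" "y \<in> carrier_vec n" "z \<in> carrier_vec n"
  shows "form P x (y + z) = form P x y + form P x z"
  unfolding form_def using P assms
  by (subst mult_add_distrib_mat_vec) (auto intro!: scalar_prod_add_distrib)

lemma form_smult_left:
  assumes "x \<in> carrier_vec n" "y \<in> carrier_vec n"
  shows "form P (a \<cdot>\<^sub>v x) y = a * form P x y"
  unfolding form_def using P assms by (intro smult_scalar_prod_distrib) auto

lemma form_smult_right:
  assumes "x \<in> carrier_vec n" "y \<in> carrier_vec n"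
  shows "form P x (a \<cdot>\<^sub>v y) = a * form P x y"
  unfolding form_def using P assms
  by (subst mult_mat_vec) (auto intro!: scalar_prod_smult_distrib)

lemma form_eq_sum:
  assumes "x \<in> carrier_vec n" "y \<in> carrier_vec n"
  shows "form P x y = (\<Sum>i<n. \<Sum>j<n. x $ i * P $$ (i, j) * y $ j)"
  unfolding form_def scalar_prod_def mult_mat_vec_def using P assms
  by (auto simp: sum_distrib_left mult.assoc lessThan_atLeast0 scalar_prod_def intro!: sum.cong)

lemma form_unit_vec:
  assumes "i < n" "j < n"
  shows "form P (unit_vec n i) (unit_vec n j) = P $$ (i, j)"
  unfolding form_def using P assms by simp

end

lemma form_limit:
  assumes "P \<in> carrier_mat n n" "\<And>N. Q N \<in> carrier_mat n n"
    and "\<And>i j. i < n \<Longrightarrow> j < n \<Longrightarrow> (\<lambda>N. Q N $$ (i, j)) \<longlonglongrightarrow> P $$ (i, j)"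
    and "x \<in> carrier_vec n" "y \<in> carrier_vec n"
  shows "(\<lambda>N. form (Q N) x y) \<longlonglongrightarrow> form P x y"
  unfolding form_eq_sum[OF assms(1,4,5)] form_eq_sum[OF assms(2,4,5)]
  by (intro tendsto_intros assms(3)) auto

text \<open>Reduces convergence to the diagonal, where monotonicity and squeezing are
  available.\<close>

lemma form_polarization:
  assumes "pos_semidef n P" "x \<in> carrier_vec n" "y \<in> carrier_vec n"
  shows "form P x y = (form P (x + y) (x + y) - form P x x - form P y y) / 2"
  using assms pos_semidefD(2)[OF assms]
  by (simp add: pos_semidefD(1) form_add_left[where n = n] form_add_right[where n = n])

text \<open>Polarization extends convergence off the diagonal; on unit vectors it gives the entries,
  whose limits form \<open>P\<close>. Symmetry and nonnegativity pass to the limit.\<close>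

lemma pos_semidef_limit:
  assumes psd: "\<And>N. pos_semidef n (Q N)"
    and conv: "\<And>x. x \<in> carrier_vec n \<Longrightarrow> convergent (\<lambda>N. form (Q N) x x)"
  obtains P where "pos_semidef n P"
    and "\<And>x y. x \<in> carrier_vec n \<Longrightarrow> y \<in> carrier_vec n \<Longrightarrow>
           (\<lambda>N. form (Q N) x y) \<longlonglongrightarrow> form P x y"
proof -
  have Q: "Q N \<in> carrier_mat n n" for N
    using psd pos_semidefD(1) by blast
  have conv2: "convergent (\<lambda>N. form (Q N) x y)"
    if "x \<in> carrier_vec n" "y \<in> carrier_vec n" for x y
    unfolding form_polarization[OF psd that] divide_inverse
    using that by (intro convergent_mult convergent_const convergent_diff conv) auto
  define P where "P = mat n n (\<lambda>(i, j). lim (\<lambda>N. Q N $$ (i, j)))"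
  have P: "P \<in> carrier_mat n n"
    by (simp add: P_def)
  have "(\<lambda>N. Q N $$ (i, j)) \<longlonglongrightarrow> P $$ (i, j)" if "i < n" "j < n" for i j
    using conv2[of "unit_vec n i" "unit_vec n j"] that Q
    by (simp add: form_unit_vec P_def convergent_LIMSEQ_iff)
  then have lim: "(\<lambda>N. form (Q N) x y) \<longlonglongrightarrow> form P x y"
    if "x \<in> carrier_vec n" "y \<in> carrier_vec n" for x y
    using form_limit[OF P, of Q] Q that by blast
  have "pos_semidef n P"
    unfolding pos_semidef_def
  proof (intro conjI ballI P)
    fix x y :: "real vec" assume xy: "x \<in> carrier_vec n" "y \<in> carrier_vec n"
    have "(\<lambda>N. form (Q N) y x) \<longlonglongrightarrow> form P x y"
      using lim[OF xy] pos_semidefD(2)[OF psd xy] by simp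
    then show "form P x y = form P y x"
      using lim[OF xy(2,1)] LIMSEQ_unique by blast
  next
    fix x :: "real vec" assume x: "x \<in> carrier_vec n"
    show "0 \<le> form P x x"
      using lim[OF x x] pos_semidefD(3)[OF psd x] by (auto intro: LIMSEQ_le_const)
  qed
  with lim show thesis using that by blast
qed

section \<open>The Riccati map as a Bellman operator\<close>

locale controlled_system =
  fixes n :: nat and A :: "real mat" and h c :: "real vec" and r :: real
  assumes A [simp]: "A \<in> carrier_mat n n"
    and h [simp]: "h \<in> carrier_vec n"
    and c [simp]: "c \<in> carrier_vec n"
    and r: "r > 0"
begin

abbreviation "F \<equiv> riccati_step A h c r"
abbreviation "K \<equiv> gain A h r"

definition succ_state :: "real \<Rightarrow> real vec \<Rightarrow> real vec" where
  "succ_state u z = A *\<^sub>v z + u \<cdot>\<^sub>v h"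

lemma A_mult_carrier [simp]: "x \<in> carrier_vec n \<Longrightarrow> A *\<^sub>v x \<in> carrier_vec n"
  by (rule mult_mat_vec_carrier) auto

lemma succ_state_carrier [simp]: "z \<in> carrier_vec n \<Longrightarrow> succ_state u z \<in> carrier_vec n"
  by (simp add: succ_state_def)

lemma gain_carrier [simp]: "P \<in> carrier_mat n n \<Longrightarrow> K P \<in> carrier_vec n"
  by (auto simp: gain_def intro!: mult_mat_vec_carrier[of _ n n])

lemma gain_scalar_prod:
  assumes P: "P \<in> carrier_mat n n" and x: "x \<in> carrier_vec n"
  shows "K P \<bullet> x = form P h (A *\<^sub>v x) / (r + form P h h)"
proof -
  have PA: "P * A \<in> carrier_mat n n"
    using P by simp
  have "(P * A)\<^sup>T *\<^sub>v h \<in> carrier_vec n"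
    using PA h by (intro mult_mat_vec_carrier) auto
  then show ?thesis
    using transpose_vec_mult_scalar[OF PA x h] P x
    by (simp add: gain_def form_def assoc_mult_mat_vec[OF P A x])
qed

lemma riccati_step_carrier [simp]: "P \<in> carrier_mat n n \<Longrightarrow> F P \<in> carrier_mat n n"
  unfolding riccati_step_def by (intro add_carrier_mat mult_carrier_mat[of _ _ n]) auto

text \<open>The outer products have rank at most one, so on vectors they become products of scalars;
  \<open>A^T\<close> moves to the left argument as its adjoint.\<close>

lemma form_riccati_step:
  assumes P: "P \<in> carrier_mat n n" and x: "x \<in> carrier_vec n" and y: "y \<in> carrier_vec n"
  shows "form (F P) x y = (c \<bullet> x) * (c \<bullet> y) + form P (A *\<^sub>v x) (A *\<^sub>v y)
    - form P (A *\<^sub>v x) h * form P h (A *\<^sub>v y) / (r + form P h h)"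
proof -
  define a where "a = 1 / (r + form P h h)"
  define M where "M = P - a \<cdot>\<^sub>m (P * outer_prod h h * P)"
  let ?x = "A *\<^sub>v x" and ?y = "A *\<^sub>v y"
  have M: "M \<in> carrier_mat n n" 
    unfolding M_def using P by (intro minus_carrier_mat smult_carrier_mat mult_carrier_mat[of _ n n]) auto
  have Py: "P *\<^sub>v ?y \<in> carrier_vec n" "P *\<^sub>v h \<in> carrier_vec n"
    using P y by (auto intro!: mult_mat_vec_carrier)
  have PO: "P * outer_prod h h \<in> carrier_mat n n"
    using P by (intro mult_carrier_mat[of _ n n]) auto
  have "(P * outer_prod h h * P) *\<^sub>v ?y = P *\<^sub>v (outer_prod h h *\<^sub>v (P *\<^sub>v ?y))"
    using P PO y Py by (simp add: assoc_mult_mat_vec[of _ n n _ n])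
  also have "\<dots> = form P h ?y \<cdot>\<^sub>v (P *\<^sub>v h)"
    using P Py by (simp add: outer_prod_mult_vec[of _ n] mult_mat_vec[of _ n n] form_def)
  finally have POP: "(P * outer_prod h h * P) *\<^sub>v ?y = form P h ?y \<cdot>\<^sub>v (P *\<^sub>v h)" .
  have "M *\<^sub>v ?y = P *\<^sub>v ?y - (a \<cdot>\<^sub>m (P * outer_prod h h * P)) *\<^sub>v ?y"
    unfolding M_def using P PO y by (intro minus_mult_distrib_mat_vec[of _ n n]) auto
  also have "(a \<cdot>\<^sub>m (P * outer_prod h h * P)) *\<^sub>v ?y = a \<cdot>\<^sub>v (form P h ?y \<cdot>\<^sub>v (P *\<^sub>v h))"
    unfolding POP[symmetric] using P PO y by (intro smult_mat_mult_vec[of _ n n]) auto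
  finally have "M *\<^sub>v ?y = P *\<^sub>v ?y - a \<cdot>\<^sub>v (form P h ?y \<cdot>\<^sub>v (P *\<^sub>v h))" .
  then have My: "?x \<bullet> (M *\<^sub>v ?y) = form P ?x ?y - a * (form P h ?y * form P ?x h)"
    using Py x
    by (simp add: form_def scalar_prod_minus_distrib[of _ n] scalar_prod_smult_distrib[of _ n])
  have "F P *\<^sub>v y = outer_prod c c *\<^sub>v y + (A\<^sup>T * M * A) *\<^sub>v y"
    unfolding riccati_step_def form_def[symmetric] a_def[symmetric] M_def[symmetric]
    using M y by (intro add_mult_distrib_mat_vec[of _ n n]) (auto intro!: mult_carrier_mat[of _ n n])
  also have "(A\<^sup>T * M * A) *\<^sub>v y = A\<^sup>T *\<^sub>v (M *\<^sub>v ?y)"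
    using M y by (simp add: assoc_mult_mat_vec[of _ n n _ n] mult_carrier_mat[of _ n n])
  finally have "form (F P) x y = x \<bullet> ((c \<bullet> y) \<cdot>\<^sub>v c) + x \<bullet> (A\<^sup>T *\<^sub>v (M *\<^sub>v ?y))"
    unfolding form_def using M x y A
    by (simp add: outer_prod_mult_vec[of _ n] scalar_prod_add_distrib[of _ n] mult_mat_vec_carrier[of _ n n])
  also have "x \<bullet> (A\<^sup>T *\<^sub>v (M *\<^sub>v ?y)) = ?x \<bullet> (M *\<^sub>v ?y)"
    using transpose_vec_mult_scalar[of "A\<^sup>T" n n "M *\<^sub>v ?y" x] M x y A
    by simp
  finally show ?thesis
    using x y by (simp add: My a_def comm_scalar_prod[of x n c])
qed

text \<open>Bellman's identity. The cost of applying \<open>u\<close> once and then paying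
  \<open>form P\<close> is quadratic in \<open>u\<close> with leading coefficient
  \<open>r + form P h h > 0\<close>; its minimum is \<open>form (F P) z z\<close>, attained at
  \<open>u = - (K P \<bullet> z)\<close>. The optimality statements below are read off from
  it.\<close>

lemma complete_square:
  assumes psd: "pos_semidef n P" and z: "z \<in> carrier_vec n"
  shows "(c \<bullet> z)\<^sup>2 + r * u\<^sup>2 + form P (succ_state u z) (succ_state u z) =
    form (F P) z z + (r + form P h h) * (u + K P \<bullet> z)\<^sup>2"
proof -
  note P = pos_semidefD(1)[OF psd]
  let ?g = "form P h (A *\<^sub>v z)" and ?d = "r + form P h h"
  have sq: "d * (u + g / d)\<^sup>2 = d * u\<^sup>2 + 2 * u * g + g * g / d" if "d > 0" for d g :: real
    using that by (simp add: field_simps power2_eq_square)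
  have "?d > 0"
    using pos_semidefD(3)[OF psd h] r by simp
  note sq[OF this, of ?g]
  moreover have "form P (A *\<^sub>v z) h = ?g"
    using pos_semidefD(2)[OF psd] z by simp
  ultimately show ?thesis
    using z P unfolding form_riccati_step[OF P z z] gain_scalar_prod[OF P z] succ_state_def
    by (simp add: form_add_left form_add_right form_smult_left form_smult_right)
       (simp add: algebra_simps power2_eq_square)
qed

text \<open>Any control may be inserted, in particular a suboptimal one: the gain of another matrix,
  a steering control, or the stationary gain.\<close>

lemma form_riccati_step_le:
  assumes psd: "pos_semidef n P" and z: "z \<in> carrier_vec n"
  shows "form (F P) z z \<le> (c \<bullet> z)\<^sup>2 + r * u\<^sup>2 + form P (succ_state u z) (succ_state u z)"
  using complete_square[OF psd z, of u] pos_semidefD(3)[OF psd h] r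
  by simp

definition closed_loop :: "real mat \<Rightarrow> real vec \<Rightarrow> real vec" where
  "closed_loop P z = succ_state (- (K P \<bullet> z)) z"

lemma closed_loop_carrier [simp]: "z \<in> carrier_vec n \<Longrightarrow> closed_loop P z \<in> carrier_vec n"
  by (simp add: closed_loop_def)

lemma form_riccati_step_closed_loop:
  assumes psd: "pos_semidef n P" and z: "z \<in> carrier_vec n"
  shows "form (F P) z z =
    (c \<bullet> z)\<^sup>2 + r * (K P \<bullet> z)\<^sup>2 + form P (closed_loop P z) (closed_loop P z)"
  using complete_square[OF psd z, of "- (K P \<bullet> z)"] by (simp add: closed_loop_def)

text \<open>Nonnegativity comes from the optimal control: the minimal cost is itself a sum of
  nonnegative costs.\<close>

lemma pos_semidef_riccati_step:
  assumes psd: "pos_semidef n P"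
  shows "pos_semidef n (F P)"
  unfolding pos_semidef_def
proof (intro conjI ballI)
  note P = pos_semidefD(1)[OF psd]
  show "F P \<in> carrier_mat n n"
    using P by simp
  fix x :: "real vec" assume x: "x \<in> carrier_vec n"
  show "0 \<le> form (F P) x x"
    using pos_semidefD(3)[OF psd closed_loop_carrier[OF x]] r
    by (simp add: form_riccati_step_closed_loop[OF psd x])
  fix y :: "real vec" assume y: "y \<in> carrier_vec n"
  show "form (F P) x y = form (F P) y x"
    using x y pos_semidefD(2)[OF psd] by (simp add: form_riccati_step[OF P])
qed

lemma pos_semidef_funpow:
  "pos_semidef n P \<Longrightarrow> pos_semidef n ((F ^^ N) P)"
  by (induction N) (auto intro: pos_semidef_riccati_step)

text \<open>The control that is optimal for \<open>P'\<close> is admissible for \<open>P\<close> and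
  costs no more there.\<close>

lemma riccati_step_mono:
  assumes "pos_semidef n P" "pos_semidef n P'"
    and "\<And>z. z \<in> carrier_vec n \<Longrightarrow> form P z z \<le> form P' z z"
    and z: "z \<in> carrier_vec n"
  shows "form (F P) z z \<le> form (F P') z z"
proof -
  let ?u = "- (K P' \<bullet> z)"
  have "form (F P) z z \<le> (c \<bullet> z)\<^sup>2 + r * ?u\<^sup>2 + form P (succ_state ?u z) (succ_state ?u z)"
    using assms by (intro form_riccati_step_le)
  also have "\<dots> \<le> (c \<bullet> z)\<^sup>2 + r * ?u\<^sup>2 + form P' (succ_state ?u z) (succ_state ?u z)"
    using assms by simp
  also have "\<dots> = form (F P') z z"
    using form_riccati_step_closed_loop[OF assms(2) z] by (simp add: closed_loop_def)
  finally show ?thesis .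
qed

lemma riccati_funpow_mono:
  assumes "pos_semidef n P" "pos_semidef n P'"
    and "\<And>z. z \<in> carrier_vec n \<Longrightarrow> form P z z \<le> form P' z z"
    and "z \<in> carrier_vec n"
  shows "form ((F ^^ N) P) z z \<le> form ((F ^^ N) P') z z"
  using assms(4)
proof (induction N arbitrary: z)
  case (Suc N)
  then show ?case
    using riccati_step_mono[OF pos_semidef_funpow[OF assms(1)] pos_semidef_funpow[OF assms(2)]]
    by simp
qed (use assms in simp)

text \<open>The gain is a quotient of forms, and the limiting denominator is at least
  \<open>r > 0\<close>.\<close>

lemma gain_tendsto:
  assumes "P \<in> carrier_mat n n" "\<And>N. Q N \<in> carrier_mat n n" "0 \<le> form P h h"
    and "\<And>x y. x \<in> carrier_vec n \<Longrightarrow> y \<in> carrier_vec n \<Longrightarrow>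
           (\<lambda>N. form (Q N) x y) \<longlonglongrightarrow> form P x y"
    and "x \<in> carrier_vec n"
  shows "(\<lambda>N. K (Q N) \<bullet> x) \<longlonglongrightarrow> K P \<bullet> x"
  using assms r by (auto simp: gain_scalar_prod intro!: tendsto_intros)


section \<open>Steering to the origin and bounded costs\<close>

lemma form_zero_mat [simp]: "x \<in> carrier_vec n \<Longrightarrow> form (0\<^sub>m n n) x x = 0"
  by (simp add: form_eq_sum[where n = n])

lemma pos_semidef_zero: "pos_semidef n (0\<^sub>m n n)"
  by (auto simp: pos_semidef_def form_eq_sum[where n = n])

lemma form_zero_vec: "P \<in> carrier_mat n n \<Longrightarrow> form P (0\<^sub>v n) (0\<^sub>v n) = 0"
  by (simp add: form_eq_sum[where n = n])

lemma pow_A_carrier [simp]: "A ^\<^sub>m i \<in> carrier_mat n n"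
  by (rule pow_carrier_mat) simp

lemma pow_A_mult_carrier [simp]: "x \<in> carrier_vec n \<Longrightarrow> (A ^\<^sub>m i) *\<^sub>v x \<in> carrier_vec n"
  by (rule mult_mat_vec_carrier) auto

lemma pow_A_succ_state:
  assumes z: "z \<in> carrier_vec n"
  shows "(A ^\<^sub>m i) *\<^sub>v succ_state u z = (A ^\<^sub>m Suc i) *\<^sub>v z + u \<cdot>\<^sub>v ((A ^\<^sub>m i) *\<^sub>v h)"
  unfolding succ_state_def using z
  by (simp add: mult_add_distrib_mat_vec[of _ n n] mult_mat_vec[of _ n n]
      assoc_mult_mat_vec[of _ n n _ n])

text \<open>Such a \<open>z\<close> can be steered to the origin in \<open>i\<close> steps, where no further cost arises.\<close>

lemma bounded_value_of_reachable:
  assumes "z \<in> carrier_vec n"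
    and "\<And>x. x \<in> carrier_vec n \<Longrightarrow>
      x \<bullet> ((A ^\<^sub>m i) *\<^sub>v z) = (\<Sum>j<i. \<alpha> j * (x \<bullet> ((A ^\<^sub>m j) *\<^sub>v h)))"
  shows "\<exists>C. \<forall>N. form ((F ^^ N) (0\<^sub>m n n)) z z \<le> C"
  using assms
proof (induction i arbitrary: z)
  case 0
  \<comment> \<open>With no summands, every vector is orthogonal to \<open>z\<close>; unit vectors
    then give \<open>z = 0\<close>.\<close>
  have "z = 0\<^sub>v n"
  proof (intro eq_vecI)
    fix k assume "k < dim_vec (0\<^sub>v n :: real vec)"
    then show "z $ k = 0\<^sub>v n $ k"
      using 0(2)[of "unit_vec n k"] 0(1) carrier_matD(1)[OF A] by simp
  qed (use 0 in auto)
  then show ?case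
    using form_zero_vec[OF pos_semidefD(1)[OF pos_semidef_funpow[OF pos_semidef_zero]]]
    by auto
next
  case (Suc i)
  note z = Suc.prems(1)
  \<comment> \<open>The control \<open>- \<alpha> i\<close> cancels the summand
    \<open>j = i\<close>, so the successor satisfies the hypothesis with \<open>i\<close>
    steps.\<close>
  let ?z = "succ_state (- \<alpha> i) z"
  have "x \<bullet> ((A ^\<^sub>m i) *\<^sub>v ?z) = (\<Sum>j<i. \<alpha> j * (x \<bullet> ((A ^\<^sub>m j) *\<^sub>v h)))"
    if x: "x \<in> carrier_vec n" for x
  proof -
    have "x \<bullet> ((A ^\<^sub>m i) *\<^sub>v ?z) =
        x \<bullet> ((A ^\<^sub>m Suc i) *\<^sub>v z) - \<alpha> i * (x \<bullet> ((A ^\<^sub>m i) *\<^sub>v h))"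
      using x z pow_A_mult_carrier[of z "Suc i"]
      by (simp add: pow_A_succ_state scalar_prod_add_distrib[of _ n] del: pow_mat.simps)
    then show ?thesis
      using Suc.prems(2)[OF x] by simp
  qed
  then obtain C where C: "form ((F ^^ N) (0\<^sub>m n n)) ?z ?z \<le> C" for N
    using Suc.IH[of ?z] z by auto
  \<comment> \<open>The maximum with \<open>0\<close> covers \<open>N = 0\<close>, where the form is
    that of the zero matrix.\<close>
  have "form ((F ^^ N) (0\<^sub>m n n)) z z \<le> max 0 ((c \<bullet> z)\<^sup>2 + r * (- \<alpha> i)\<^sup>2 + C)" for N
  proof (cases N)
    case (Suc N')
    then show ?thesis
      using form_riccati_step_le[OF pos_semidef_funpow[OF pos_semidef_zero] z, of N' "- \<alpha> i"]
        C[of N'] by simp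
  qed (use z in simp)
  then show ?case by blast
qed

end

section \<open>Convergence of the value iteration\<close>

text \<open>The two rank conditions as expansions. Reachability is stated by pairing with all
  \<open>x\<close>, which keeps every sum scalar.\<close>

locale reachable_observable_system = controlled_system +
  assumes reachable: "\<And>z. z \<in> carrier_vec n \<Longrightarrow>
      \<exists>\<alpha>. \<forall>x\<in>carrier_vec n. x \<bullet> z = (\<Sum>j<n. \<alpha> j * (x \<bullet> ((A ^\<^sub>m j) *\<^sub>v h)))"
    and observable: "\<exists>\<beta>. \<forall>z\<in>carrier_vec n. \<forall>i<n. z $ i = (\<Sum>j<n. \<beta> i j * (c \<bullet> ((A ^\<^sub>m j) *\<^sub>v z)))"
begin

lemma value_iteration_from_zero:
  obtains P where "pos_semidef n P"
    and "\<And>x y. x \<in> carrier_vec n \<Longrightarrow> y \<in> carrier_vec n \<Longrightarrow>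
      (\<lambda>N. form ((F ^^ N) (0\<^sub>m n n)) x y) \<longlonglongrightarrow> form P x y"
proof -
  let ?Q = "\<lambda>N. (F ^^ N) (0\<^sub>m n n)"
  note psd = pos_semidef_funpow[OF pos_semidef_zero]
  have conv: "convergent (\<lambda>N. form (?Q N) z z)" if z: "z \<in> carrier_vec n" for z
  proof -
    \<comment> \<open>Reachability is applied to \<open>A^n z\<close>: after \<open>n\<close> steps
      the controls have to cancel exactly this free motion.\<close>
    obtain \<alpha> where "\<forall>x\<in>carrier_vec n.
        x \<bullet> ((A ^\<^sub>m n) *\<^sub>v z) = (\<Sum>j<n. \<alpha> j * (x \<bullet> ((A ^\<^sub>m j) *\<^sub>v h)))"
      using reachable[of "(A ^\<^sub>m n) *\<^sub>v z"] z by auto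
    then obtain C where C: "form (?Q N) z z \<le> C" for N
      using bounded_value_of_reachable[OF z, of n \<alpha>] by auto
    \<comment> \<open>Since \<open>F^(N+1) 0 = F^N (F 0)\<close>, monotonicity only has to compare
      the starting points \<open>0\<close> and \<open>F 0\<close>.\<close>
    have "form (?Q N) z z \<le> form (?Q (Suc N)) z z" for N
      unfolding funpow_Suc_right comp_def
      using riccati_funpow_mono[OF pos_semidef_zero pos_semidef_riccati_step[OF pos_semidef_zero]]
        pos_semidefD(3)[OF pos_semidef_riccati_step[OF pos_semidef_zero]] z
      by simp
    then have "incseq (\<lambda>N. form (?Q N) z z)"
      by (rule incseq_SucI)
    then obtain L where "(\<lambda>N. form (?Q N) z z) \<longlonglongrightarrow> L"
      using incseq_convergent[of "\<lambda>N. form (?Q N) z z" C] C by blast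
    then show ?thesis
      by (rule convergentI)
  qed
  show thesis
    using pos_semidef_limit[OF psd conv] that by blast
qed

section \<open>The limit matrix: stationarity, stability and attraction\<close>

context
  fixes P :: "real mat"
  assumes psd: "pos_semidef n P"
    and lim: "\<And>x y. x \<in> carrier_vec n \<Longrightarrow> y \<in> carrier_vec n \<Longrightarrow>
      (\<lambda>N. form ((F ^^ N) (0\<^sub>m n n)) x y) \<longlonglongrightarrow> form P x y"
begin

text \<open>The shifted sequence keeps its limit, and by continuity of the Riccati formula it also
  tends to \<open>form (F P) z z\<close>; limits are unique.\<close>

lemma value_fixpoint:
  assumes z: "z \<in> carrier_vec n"
  shows "form (F P) z z = form P z z"
proof -
  let ?Q = "\<lambda>N. (F ^^ N) (0\<^sub>m n n)"
  note Q = pos_semidefD(1)[OF pos_semidef_funpow[OF pos_semidef_zero]]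
  note P = pos_semidefD(1)[OF psd]
  have "(\<lambda>N. form (?Q (Suc N)) z z) \<longlonglongrightarrow> form (F P) z z"
    using z pos_semidefD(3)[OF psd h] r
    by (auto simp: form_riccati_step[OF Q] form_riccati_step[OF P] intro!: tendsto_intros lim)
  moreover have "(\<lambda>N. form (?Q (Suc N)) z z) \<longlonglongrightarrow> form P z z"
    using lim[OF z z] by (rule LIMSEQ_Suc)
  ultimately show ?thesis
    by (rule LIMSEQ_unique)
qed

text \<open>Makes \<open>form P\<close> a Lyapunov function of the closed loop, with the running
  cost as its exact decrease.\<close>

lemma closed_loop_decrease:
  assumes z: "z \<in> carrier_vec n"
  shows "form P z z =
    (c \<bullet> z)\<^sup>2 + r * (K P \<bullet> z)\<^sup>2 + form P (closed_loop P z) (closed_loop P z)"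
  using form_riccati_step_closed_loop[OF psd z] value_fixpoint[OF z] by simp

text \<open>Telescoping makes the running cost summable, so output and control both vanish.
  Observability concerns uncontrolled powers of \<open>A\<close>, and the vanishing control is what
  links these to the trajectory.\<close>

lemma closed_loop_tendsto_zero:
  assumes z: "\<And>m. z m \<in> carrier_vec n" and step: "\<And>m. z (Suc m) = closed_loop P (z m)"
    and i: "i < n"
  shows "(\<lambda>m. z m $ i) \<longlonglongrightarrow> 0"
proof -
  let ?cost = "\<lambda>m. (c \<bullet> z m)\<^sup>2 + r * (K P \<bullet> z m)\<^sup>2"
  have "(\<Sum>m<N. ?cost m) = form P (z 0) (z 0) - form P (z N) (z N)" for N
    using closed_loop_decrease[OF z] step by (induction N) (auto simp: algebra_simps)
  then have "(\<Sum>m<N. ?cost m) \<le> form P (z 0) (z 0)" for N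
    using pos_semidefD(3)[OF psd z] by simp
  then have "summable ?cost"
    using r by (intro summableI_nonneg_bounded) auto
  then have cost: "?cost \<longlonglongrightarrow> 0"
    by (rule summable_LIMSEQ_zero)
  have "(\<lambda>m. (c \<bullet> z m)\<^sup>2) \<longlonglongrightarrow> 0"
    using r by (intro tendsto_sandwich[OF _ _ tendsto_const cost]) auto
  then have cz: "(\<lambda>m. c \<bullet> z m) \<longlonglongrightarrow> 0"
    by simp
  have "(\<lambda>m. r * (K P \<bullet> z m)\<^sup>2) \<longlonglongrightarrow> 0"
    using r by (intro tendsto_sandwich[OF _ _ tendsto_const cost]) auto
  then have "(\<lambda>m. (1 / r) * (r * (K P \<bullet> z m)\<^sup>2)) \<longlonglongrightarrow> (1 / r) * 0"
    by (intro tendsto_intros)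
  then have kz: "(\<lambda>m. K P \<bullet> z m) \<longlonglongrightarrow> 0"
    using r by simp
  have obs: "(\<lambda>m. c \<bullet> ((A ^\<^sub>m j) *\<^sub>v z m)) \<longlonglongrightarrow> 0" for j
  proof (induction j)
    case 0
    show ?case
      using cz z carrier_matD(1)[OF A] by simp
  next
    case (Suc j)
    \<comment> \<open>\<open>A^(j+1) z_m\<close> differs from \<open>A^j z_(m+1)\<close>, which the
      induction hypothesis controls, only by a multiple of the feedback value.\<close>
    have "c \<bullet> ((A ^\<^sub>m Suc j) *\<^sub>v z m) =
        c \<bullet> ((A ^\<^sub>m j) *\<^sub>v z (Suc m)) + (K P \<bullet> z m) * (c \<bullet> ((A ^\<^sub>m j) *\<^sub>v h))" for m
      unfolding step closed_loop_def pow_A_succ_state[OF z]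
      using z pow_A_mult_carrier[of "z m" "Suc j"]
      by (simp add: scalar_prod_add_distrib[of _ n] scalar_prod_smult_distrib[of _ n]
          del: pow_mat.simps)
    moreover have "(\<lambda>m. c \<bullet> ((A ^\<^sub>m j) *\<^sub>v z (Suc m)) + (K P \<bullet> z m) * (c \<bullet> ((A ^\<^sub>m j) *\<^sub>v h)))
        \<longlonglongrightarrow> 0 + 0 * (c \<bullet> ((A ^\<^sub>m j) *\<^sub>v h))"
      using LIMSEQ_Suc[OF Suc.IH] by (intro tendsto_intros kz)
    ultimately show ?case
      by simp
  qed
  obtain \<beta> where "\<forall>z\<in>carrier_vec n. \<forall>i<n. z $ i = (\<Sum>j<n. \<beta> i j * (c \<bullet> ((A ^\<^sub>m j) *\<^sub>v z)))"
    using observable by blast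
  then have "z m $ i = (\<Sum>j<n. \<beta> i j * (c \<bullet> ((A ^\<^sub>m j) *\<^sub>v z m)))" for m
    using z i by blast
  moreover have "(\<lambda>m. \<Sum>j<n. \<beta> i j * (c \<bullet> ((A ^\<^sub>m j) *\<^sub>v z m))) \<longlonglongrightarrow> (\<Sum>j<n. \<beta> i j * 0)"
    by (intro tendsto_intros obs)
  ultimately show ?thesis
    by simp
qed

text \<open>The gain of \<open>P\<close> is merely admissible for terminal cost \<open>S\<close>;
  its running cost over \<open>N\<close> steps telescopes to the drop of \<open>form P\<close> along
  the trajectory.\<close>

lemma value_iteration_upper_bound:
  assumes S: "pos_semidef n S" and z: "z \<in> carrier_vec n"
  shows "form ((F ^^ N) S) z z \<le> form P z z
    - form P ((closed_loop P ^^ N) z) ((closed_loop P ^^ N) z)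
    + form S ((closed_loop P ^^ N) z) ((closed_loop P ^^ N) z)"
  using z
proof (induction N arbitrary: z)
  case (Suc N)
  have "form ((F ^^ Suc N) S) z z \<le> (c \<bullet> z)\<^sup>2 + r * (K P \<bullet> z)\<^sup>2
      + form ((F ^^ N) S) (closed_loop P z) (closed_loop P z)"
    using form_riccati_step_le[OF pos_semidef_funpow[OF S] Suc.prems, of N "- (K P \<bullet> z)"]
    by (simp add: closed_loop_def)
  then show ?case
    using Suc.IH[OF closed_loop_carrier[OF Suc.prems, of P]] closed_loop_decrease[OF Suc.prems]
    by (simp add: funpow_swap1)
qed simp

text \<open>A squeeze on the diagonal: below lies the iteration from zero, above the stationary
  gain, whose boundary terms vanish with the closed-loop state.\<close>

lemma value_iteration_tendsto:
  assumes S: "pos_semidef n S" and xy: "x \<in> carrier_vec n" "y \<in> carrier_vec n"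
  shows "(\<lambda>N. form ((F ^^ N) S) x y) \<longlonglongrightarrow> form P x y"
proof -
  have diag: "(\<lambda>N. form ((F ^^ N) S) z z) \<longlonglongrightarrow> form P z z" if z: "z \<in> carrier_vec n" for z
  proof -
    let ?z = "\<lambda>N. (closed_loop P ^^ N) z"
    have zN: "?z N \<in> carrier_vec n" for N
      using z by (induction N) auto
    have z0: "(\<lambda>N. ?z N $ i) \<longlonglongrightarrow> 0" if "i < n" for i
      by (rule closed_loop_tendsto_zero) (use zN that in auto)
    have form0: "(\<lambda>N. form M (?z N) (?z N)) \<longlonglongrightarrow> 0" if M: "M \<in> carrier_mat n n" for M
    proof -
      have "(\<lambda>N. \<Sum>i<n. \<Sum>j<n. ?z N $ i * M $$ (i, j) * ?z N $ j)
          \<longlonglongrightarrow> (\<Sum>i<n. \<Sum>j<n. 0 * M $$ (i, j) * 0)"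
        by (intro tendsto_intros z0) auto
      then show ?thesis
        by (simp add: form_eq_sum[OF M zN zN])
    qed
    have upper: "(\<lambda>N. form P z z - form P (?z N) (?z N) + form S (?z N) (?z N)) \<longlonglongrightarrow> form P z z - 0 + 0"
      by (intro tendsto_intros form0 pos_semidefD(1)[OF psd] pos_semidefD(1)[OF S])
    show ?thesis
    proof (rule tendsto_sandwich[OF _ _ lim[OF z z]])
      show "\<forall>\<^sub>F N in sequentially. form ((F ^^ N) (0\<^sub>m n n)) z z \<le> form ((F ^^ N) S) z z"
        using riccati_funpow_mono[OF pos_semidef_zero S _ z] pos_semidefD(3)[OF S] by simp
      show "\<forall>\<^sub>F N in sequentially. form ((F ^^ N) S) z z \<le>
          form P z z - form P (?z N) (?z N) + form S (?z N) (?z N)"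
        using value_iteration_upper_bound[OF S z] by simp
    qed (use upper in simp)
  qed
  show ?thesis
    unfolding form_polarization[OF psd xy] form_polarization[OF pos_semidef_funpow[OF S] xy]
    using xy by (intro tendsto_intros diag) auto
qed

end

end


section \<open>Rank conditions and spectral radius\<close>

lemma pow_smult_mat:
  assumes "(M :: real mat) \<in> carrier_mat n n"
  shows "(a \<cdot>\<^sub>m M) ^\<^sub>m i = a ^ i \<cdot>\<^sub>m (M ^\<^sub>m i)"
proof (induction i)
  case 0
  then show ?case using assms by (intro eq_matI) auto
next
  case (Suc i)
  have "M ^\<^sub>m i \<in> carrier_mat n n"
    using assms by (rule pow_carrier_mat)
  then show ?case
    using assms Suc by (intro eq_matI) auto
qed

lemma full_rank_inverse:
  fixes M :: "real mat"
  assumes M: "M \<in> carrier_mat n n" and rank: "vec_space.rank n M = n"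
  obtains B where "B \<in> carrier_mat n n" "B * M = 1\<^sub>m n" "M * B = 1\<^sub>m n"
proof -
  have "det M \<noteq> 0"
    using vec_space.det_rank_iff[OF M] rank by simp
  \<comment> \<open>\<open>undefined\<close> fills the extension field of the ring record.\<close>
  then show thesis
    using det_non_zero_imp_unit[OF M, of undefined] that
    by (auto simp: Units_def ring_mat_def)
qed

text \<open>The coefficients are the coordinates of \<open>z\<close> in the basis of columns,
  obtained from the inverse of the controllability matrix.\<close>

lemma controllable_expansion:
  assumes M: "M \<in> carrier_mat n n" and h: "h \<in> carrier_vec n" and z: "z \<in> carrier_vec n"
    and rank: "vec_space.rank n (controllability_mat n M h) = n"
  shows "\<exists>\<alpha>. \<forall>x\<in>carrier_vec n. x \<bullet> z = (\<Sum>j<n. \<alpha> j * (x \<bullet> ((M ^\<^sub>m j) *\<^sub>v h)))"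
proof -
  let ?C = "controllability_mat n M h"
  have C: "?C \<in> carrier_mat n n"
    unfolding controllability_mat_def
    by (metis length_map length_upt mat_of_cols_carrier(1) minus_nat.diff_0)
  have Mj: "M ^\<^sub>m j \<in> carrier_mat n n" for j
    using M by (rule pow_carrier_mat)
  obtain B where B: "B \<in> carrier_mat n n" "?C * B = 1\<^sub>m n"
    using full_rank_inverse[OF C rank] by metis
  define a where "a = B *\<^sub>v z"
  have a: "a \<in> carrier_vec n"
    using B z by (simp add: a_def mult_mat_vec_carrier[of _ n n])
  have Ca: "?C *\<^sub>v a = z"
    using assoc_mult_mat_vec[OF C B(1) z] B(2) z by (simp add: a_def)
  have "x \<bullet> z = (\<Sum>j<n. a $ j * (x \<bullet> ((M ^\<^sub>m j) *\<^sub>v h)))" if x: "x \<in> carrier_vec n" for x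
  proof -
    have "x \<bullet> z = (\<Sum>i<n. \<Sum>j<n. x $ i * ?C $$ (i, j) * a $ j)"
      using form_eq_sum[OF C x a] by (simp add: form_def Ca)
    also have "\<dots> = (\<Sum>j<n. \<Sum>i<n. x $ i * ?C $$ (i, j) * a $ j)"
      by (rule sum.swap)
    also have "\<dots> = (\<Sum>j<n. a $ j * (x \<bullet> ((M ^\<^sub>m j) *\<^sub>v h)))"
    proof (rule sum.cong[OF refl])
      fix j assume "j \<in> {..<n}"
      then have "?C $$ (i, j) = ((M ^\<^sub>m j) *\<^sub>v h) $ i" if "i < n" for i
        using that by (simp add: controllability_mat_def mat_of_cols_index)
      moreover have "dim_vec ((M ^\<^sub>m j) *\<^sub>v h) = n"
        using carrier_matD(1)[OF Mj[of j]] by (simp only: dim_mult_mat_vec)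
      ultimately show "(\<Sum>i<n. x $ i * ?C $$ (i, j) * a $ j) = a $ j * (x \<bullet> ((M ^\<^sub>m j) *\<^sub>v h))"
        by (simp add: scalar_prod_def sum_distrib_left lessThan_atLeast0 mult_ac
            del: index_mult_mat_vec)
    qed
    finally show ?thesis .
  qed
  then show ?thesis by blast
qed

text \<open>Row \<open>j\<close> of the observability matrix applied to \<open>z\<close> gives the
  output of \<open>M^j z\<close>; the entries of the inverse matrix are the coefficients.\<close>

lemma observable_expansion:
  assumes M: "M \<in> carrier_mat n n" and c: "c \<in> carrier_vec n"
    and rank: "vec_space.rank n (observability_mat n M c) = n"
  obtains \<beta> where "\<And>z i. z \<in> carrier_vec n \<Longrightarrow> i < n \<Longrightarrow>
    z $ i = (\<Sum>j<n. \<beta> i j * (c \<bullet> ((M ^\<^sub>m j) *\<^sub>v z)))"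
proof -
  let ?O = "observability_mat n M c"
  have O: "?O \<in> carrier_mat n n"
    unfolding observability_mat_def
    by (metis length_map length_upt mat_of_rows_carrier(1) minus_nat.diff_0)
  have Mj: "M ^\<^sub>m j \<in> carrier_mat n n" for j
    using M by (rule pow_carrier_mat)
  obtain B where B: "B \<in> carrier_mat n n" "B * ?O = 1\<^sub>m n"
    using full_rank_inverse[OF O rank] by metis
  have "z $ i = (\<Sum>j<n. B $$ (i, j) * (c \<bullet> ((M ^\<^sub>m j) *\<^sub>v z)))"
    if z: "z \<in> carrier_vec n" and i: "i < n" for z i
  proof -
    have Oz: "(?O *\<^sub>v z) $ j = c \<bullet> ((M ^\<^sub>m j) *\<^sub>v z)" if "j < n" for j
    proof -
      have "(M ^\<^sub>m j)\<^sup>T *\<^sub>v c \<in> carrier_vec n"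
        using Mj[of j] c by (intro mult_mat_vec_carrier[of _ n n]) auto
      then have "row ?O j = (M ^\<^sub>m j)\<^sup>T *\<^sub>v c"
        using that unfolding observability_mat_def by (subst mat_of_rows_row) auto
      then show ?thesis
        using transpose_vec_mult_scalar[OF Mj z c] that O by simp
    qed
    have "z = B *\<^sub>v (?O *\<^sub>v z)"
      using assoc_mult_mat_vec[OF B(1) O z] B(2) z by simp
    then have "z $ i = (B *\<^sub>v (?O *\<^sub>v z)) $ i"
      by simp
    also have "\<dots> = (\<Sum>j<n. B $$ (i, j) * (?O *\<^sub>v z) $ j)"
      using B(1) O i by (simp add: scalar_prod_def lessThan_atLeast0 del: index_mult_mat_vec)
        (simp add: scalar_prod_def)
    also have "\<dots> = (\<Sum>j<n. B $$ (i, j) * (c \<bullet> ((M ^\<^sub>m j) *\<^sub>v z)))"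
      by (intro sum.cong) (auto simp: Oz simp del: index_mult_mat_vec)
    finally show ?thesis .
  qed
  then show thesis
    using that[of "\<lambda>i j. B $$ (i, j)"] by blast
qed

text \<open>Scaling multiplies \<open>M^j h\<close> by \<open>a^(j+1)\<close> and
  \<open>c^T M^j\<close> by \<open>a^j\<close>, so the coefficients are divided by these
  powers.\<close>

lemma reachable_observable_system_scaled:
  assumes M: "M \<in> carrier_mat n n" and h: "h \<in> carrier_vec n" and c: "c \<in> carrier_vec n"
    and ctrl: "vec_space.rank n (controllability_mat n M h) = n"
    and obs: "vec_space.rank n (observability_mat n M c) = n"
    and "r > 0" and a: "a \<noteq> 0"
  shows "reachable_observable_system n (a \<cdot>\<^sub>m M) (a \<cdot>\<^sub>v h) c r"
proof unfold_locales
  have Mj: "M ^\<^sub>m j \<in> carrier_mat n n" for j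
    using M by (rule pow_carrier_mat)
  have pow: "((a \<cdot>\<^sub>m M) ^\<^sub>m j) *\<^sub>v x = a ^ j \<cdot>\<^sub>v ((M ^\<^sub>m j) *\<^sub>v x)" if "x \<in> carrier_vec n" for j x
    using that Mj by (simp add: pow_smult_mat[OF M] smult_mat_mult_vec[of _ n n])
  have Mx: "(M ^\<^sub>m j) *\<^sub>v x \<in> carrier_vec n" if "x \<in> carrier_vec n" for j x
    using that Mj by (rule mult_mat_vec_carrier[rotated])
  show "\<exists>\<alpha>. \<forall>x\<in>carrier_vec n. x \<bullet> z =
      (\<Sum>j<n. \<alpha> j * (x \<bullet> (((a \<cdot>\<^sub>m M) ^\<^sub>m j) *\<^sub>v (a \<cdot>\<^sub>v h))))"
    if z: "z \<in> carrier_vec n" for z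
  proof -
    obtain \<alpha> where "\<forall>x\<in>carrier_vec n. x \<bullet> z = (\<Sum>j<n. \<alpha> j * (x \<bullet> ((M ^\<^sub>m j) *\<^sub>v h)))"
      using controllable_expansion[OF M h z ctrl] by blast
    then show ?thesis
      using a h Mx[OF h]
      by (intro exI[of _ "\<lambda>j. \<alpha> j / a ^ Suc j"])
        (simp add: pow mult_mat_vec[OF Mj h] scalar_prod_smult_distrib[of _ n])
  qed
  obtain \<beta> where \<beta>: "\<And>z i. z \<in> carrier_vec n \<Longrightarrow> i < n \<Longrightarrow>
      z $ i = (\<Sum>j<n. \<beta> i j * (c \<bullet> ((M ^\<^sub>m j) *\<^sub>v z)))"
    using observable_expansion[OF M c obs] by blast
  show "\<exists>\<beta>. \<forall>z\<in>carrier_vec n. \<forall>i<n. z $ i =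
      (\<Sum>j<n. \<beta> i j * (c \<bullet> (((a \<cdot>\<^sub>m M) ^\<^sub>m j) *\<^sub>v z)))"
  proof (intro exI[of _ "\<lambda>i j. \<beta> i j / a ^ j"] ballI allI impI)
    fix z :: "real vec" and i assume "z \<in> carrier_vec n" "i < n"
    then show "z $ i = (\<Sum>j<n. \<beta> i j / a ^ j * (c \<bullet> (((a \<cdot>\<^sub>m M) ^\<^sub>m j) *\<^sub>v z)))"
      using a c Mx by (simp add: pow \<beta>[of z i] scalar_prod_smult_distrib[of _ n])
  qed
qed (use assms in auto)

section \<open>Decaying trajectories and the spectral radius\<close>

lemma map_vec_Re_Im_mult_of_real_mat:
  assumes "M \<in> carrier_mat n n" "v \<in> carrier_vec n"
  shows "map_vec Re (map_mat complex_of_real M *\<^sub>v v) = M *\<^sub>v map_vec Re v"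
    and "map_vec Im (map_mat complex_of_real M *\<^sub>v v) = M *\<^sub>v map_vec Im v"
  using assms by (auto intro!: eq_vecI simp: scalar_prod_def)

text \<open>For an eigenvector \<open>v\<close> with eigenvalue \<open>\<mu>\<close>, the real and imaginary parts of
  \<open>(\<mu> / w)^m v\<close> are trajectories of the recursion below.\<close>

lemma spectral_radius_less_of_convergent:
  assumes n: "n \<ge> 1" and M: "M \<in> carrier_mat n n" and w: "w > 0"
    and conv: "\<And>z i. (\<And>m. z m \<in> carrier_vec n) \<Longrightarrow>
      (\<And>m. z (Suc m) = (1 / w) \<cdot>\<^sub>v (M *\<^sub>v z m)) \<Longrightarrow> i < n \<Longrightarrow> (\<lambda>m. z m $ i) \<longlonglongrightarrow> 0"
  shows "spectral_radius (map_mat complex_of_real M) < w"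
proof -
  let ?M = "map_mat complex_of_real M"
  have M': "?M \<in> carrier_mat n n"
    using M by simp
  \<comment> \<open>Since \<open>n \<ge> 1\<close>, the spectrum is nonempty and the spectral radius
    is attained by an eigenvalue.\<close>
  obtain \<mu> where \<mu>: "\<mu> \<in> spectrum ?M" "spectral_radius ?M = norm \<mu>"
    using spectral_radius_mem_max(1)[OF M'] n by auto
  then obtain v where v: "v \<in> carrier_vec n" "v \<noteq> 0\<^sub>v n" "?M *\<^sub>v v = \<mu> \<cdot>\<^sub>v v"
    using M by (auto simp: spectrum_def eigenvalue_def eigenvector_def)
  then obtain i where i: "i < n" "v $ i \<noteq> 0"
    by (metis carrier_vecD eq_vecI index_zero_vec)
  define q where "q = \<mu> / of_real w"
  define Z where "Z m = q ^ m \<cdot>\<^sub>v v" for m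
  have Z: "Z m \<in> carrier_vec n" for m
    using v by (simp add: Z_def)
  \<comment> \<open>Multiplying by \<open>M\<close> and dividing by \<open>w\<close> advances the
    index by one; \<open>M\<close> being real, this holds for real and imaginary parts
    separately.\<close>
  have "?M *\<^sub>v Z m = of_real w \<cdot>\<^sub>v Z (Suc m)" for m
    using v w by (auto simp: Z_def mult_mat_vec[OF M'] q_def smult_smult_assoc mult_ac)
  then have Re: "M *\<^sub>v map_vec Re (Z m) = map_vec Re (of_real w \<cdot>\<^sub>v Z (Suc m))"
    and Im: "M *\<^sub>v map_vec Im (Z m) = map_vec Im (of_real w \<cdot>\<^sub>v Z (Suc m))" for m
    using map_vec_Re_Im_mult_of_real_mat[OF M Z] by metis+
  have "(\<lambda>m. map_vec Re (Z m) $ i) \<longlonglongrightarrow> 0" "(\<lambda>m. map_vec Im (Z m) $ i) \<longlonglongrightarrow> 0"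
    using i Z w by (auto intro!: conv eq_vecI simp: Re Im)
  then have "(\<lambda>m. Z m $ i) \<longlonglongrightarrow> 0"
    using i Z carrier_vecD[OF Z] by (simp add: tendsto_complex_iff)
  then have lim: "(\<lambda>m. norm (q ^ m * v $ i)) \<longlonglongrightarrow> 0"
    using i v by (simp add: Z_def tendsto_norm_zero)
  \<comment> \<open>Otherwise coordinate \<open>i\<close>, nonzero at the start, would never fall
    below its initial modulus.\<close>
  have "norm q < 1"
  proof (rule ccontr)
    assume "\<not> norm q < 1"
    then have "norm (v $ i) \<le> norm (q ^ m * v $ i)" for m
      using mult_right_mono[OF one_le_power[of "norm q" m], of "norm (v $ i)"]
      by (simp add: norm_mult norm_power)
    then have "norm (v $ i) \<le> 0"
      using LIMSEQ_le_const[OF lim] by blast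
    with i show False by simp
  qed
  then show ?thesis
    using w \<mu> by (simp add: q_def norm_divide)
qed

section \<open>Convergence of the gains and the spectral bound\<close>

theorem mainTheorem1:
  fixes n :: nat and \<Phi> S :: "real mat" and h c :: "real vec" and r w :: real
  assumes "n \<ge> 1"
    and "\<Phi> \<in> carrier_mat n n" and "h \<in> carrier_vec n" and "c \<in> carrier_vec n"
    and "vec_space.rank n (controllability_mat n \<Phi> h) = n"
    and "sym_pos_def n S"
    and "r > 0"
    and "vec_space.rank n (observability_mat n \<Phi> c) = n"
    and "w > 0"
  defines "\<Phi>\<^sub>w \<equiv> (1 / w) \<cdot>\<^sub>m \<Phi>"
    and "h\<^sub>w \<equiv> (1 / w) \<cdot>\<^sub>v h"
  defines "k\<^sub>w \<equiv> vec_lim n (riccati_gain \<Phi>\<^sub>w h\<^sub>w c r S)"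
  shows "vec_tendsto n (riccati_gain \<Phi>\<^sub>w h\<^sub>w c r S) k\<^sub>w \<and>
    spectral_radius (map_mat complex_of_real (\<Phi> - outer_prod h k\<^sub>w)) < w"
proof -
  interpret reachable_observable_system n \<Phi>\<^sub>w h\<^sub>w c r
    unfolding \<Phi>\<^sub>w_def h\<^sub>w_def using assms by (intro reachable_observable_system_scaled) auto
  obtain P where P: "pos_semidef n P"
    and lim: "\<And>x y. x \<in> carrier_vec n \<Longrightarrow> y \<in> carrier_vec n \<Longrightarrow>
      (\<lambda>N. form ((F ^^ N) (0\<^sub>m n n)) x y) \<longlonglongrightarrow> form P x y"
    using value_iteration_from_zero by blast
  have S: "pos_semidef n S"
    unfolding pos_semidef_def
  proof (intro conjI ballI)
    show carr: "S \<in> carrier_mat n n"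
      using assms by (simp add: sym_pos_def_def)
    fix x :: "real vec" assume x: "x \<in> carrier_vec n"
    \<comment> \<open>Positive definiteness says nothing at the zero vector, which is treated
      separately.\<close>
    show "0 \<le> form S x x"
      using x assms form_zero_vec[OF carr] 
      by (cases "x = 0\<^sub>v n") (auto simp: sym_pos_def_def form_def less_imp_le)
    fix y :: "real vec" assume y: "y \<in> carrier_vec n"
    show "form S x y = form S y x"
      using transpose_vec_mult_scalar[OF carr y x] comm_scalar_prod[of "S *\<^sub>v x" n y] carr x y assms
      by (simp add: sym_pos_def_def form_def mult_mat_vec_carrier[of _ n n])
  qed
  note carr = pos_semidefD(1)[OF pos_semidef_funpow[OF S]] pos_semidefD(1)[OF P]
  \<comment> \<open>Components are pairings with unit vectors, the shape in which convergence of
    gains is available.\<close>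
  have gain_i: "K Q $ i = K Q \<bullet> unit_vec n i" if "Q \<in> carrier_mat n n" "i < n" for Q i
    using that gain_carrier[OF that(1)] by simp
  have "(\<lambda>N. K ((F ^^ N) S) \<bullet> unit_vec n i) \<longlonglongrightarrow> K P \<bullet> unit_vec n i" for i
    using carr pos_semidefD(3)[OF P h] value_iteration_tendsto[OF P lim S]
    by (intro gain_tendsto) auto
  then have *: "(\<lambda>N. K ((F ^^ N) S) $ i) \<longlonglongrightarrow> K P $ i" if "i < n" for i
    using gain_i[OF carr(1) that] gain_i[OF carr(2) that] by simp
  \<comment> \<open>The \<open>N\<close>-th gain uses \<open>N - 1\<close> iterations; passing to
    \<open>Suc N\<close> removes the truncated subtraction.\<close>
  have tends: "(\<lambda>N. riccati_gain \<Phi>\<^sub>w h\<^sub>w c r S N $ i) \<longlonglongrightarrow> K P $ i" if "i < n" for i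
    by (rule LIMSEQ_imp_Suc) (simp add: riccati_gain_eq * that)
  have KP: "K P \<in> carrier_vec n"
    using carr by simp
  have k: "k\<^sub>w = K P"
    unfolding k\<^sub>w_def vec_lim_def using KP tends by (intro eq_vecI) (auto intro: limI)
  have "vec_tendsto n (riccati_gain \<Phi>\<^sub>w h\<^sub>w c r S) k\<^sub>w"
    unfolding vec_tendsto_def k using tends KP carr by (auto simp: riccati_gain_eq)
  moreover have "spectral_radius (map_mat complex_of_real (\<Phi> - outer_prod h k\<^sub>w)) < w"
  proof (rule spectral_radius_less_of_convergent)
    have hk: "outer_prod h (K P) \<in> carrier_mat n n"
      using assms KP by simp
    then show "\<Phi> - outer_prod h k\<^sub>w \<in> carrier_mat n n"
      unfolding k by (rule minus_carrier_mat)
    \<comment> \<open>The factor \<open>1 / w\<close> is common to both terms of the scaled system,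
      so its closed loop is \<open>\<Phi> - h k^T\<close> divided by \<open>w\<close>, as the
      spectral criterion requires.\<close>
    have step: "closed_loop P x = (1 / w) \<cdot>\<^sub>v ((\<Phi> - outer_prod h k\<^sub>w) *\<^sub>v x)"
      if x: "x \<in> carrier_vec n" for x
    proof -
      have "(\<Phi> - outer_prod h k\<^sub>w) *\<^sub>v x = \<Phi> *\<^sub>v x - (K P \<bullet> x) \<cdot>\<^sub>v h"
        unfolding k using assms hk x KP
        by (simp add: minus_mult_distrib_mat_vec[of _ n n] outer_prod_mult_vec[of _ n])
      moreover have "closed_loop P x = (1 / w) \<cdot>\<^sub>v (\<Phi> *\<^sub>v x) + (- (K P \<bullet> x)) \<cdot>\<^sub>v ((1 / w) \<cdot>\<^sub>v h)"
        using assms(2) x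
        by (simp add: closed_loop_def succ_state_def smult_mat_mult_vec[of _ n n]
            flip: \<Phi>\<^sub>w_def h\<^sub>w_def) (simp add: \<Phi>\<^sub>w_def smult_mat_mult_vec[of _ n n])
      ultimately show ?thesis
        using assms(2,3) x by (auto intro!: eq_vecI simp: algebra_simps)
    qed
    fix z :: "nat \<Rightarrow> real vec" and i
    assume "\<And>m. z m \<in> carrier_vec n" "i < n"
      and "\<And>m. z (Suc m) = (1 / w) \<cdot>\<^sub>v ((\<Phi> - outer_prod h k\<^sub>w) *\<^sub>v z m)"
    then show "(\<lambda>m. z m $ i) \<longlonglongrightarrow> 0"
      using closed_loop_tendsto_zero[OF P lim, of z i] step by simp
  qed (use assms in auto)
  ultimately show ?thesis ..
qed

end
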